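(* Let $Q(D)$ and $P(D)$ be differential operators with constant coefficients in $\widetilde{\mathbb{C}}$. The following statements are equivalent: (i) $Q(D)\prec P(D)$; (ii) there exist representatives $(Q_\varepsilon)_\varepsilon$ and $(P_\varepsilon)_\varepsilon$ and a moderate net $(\lambda_\varepsilon)_\varepsilon$ such that $|Q_\varepsilon(\xi)|\le\lambda_\varepsilon\widetilde{P_\varepsilon}(\xi)$ for all $\xi\in\mathbb{R}^n$ and $\varepsilon\in(0,1]$; (iii) there exist representatives $(Q_\varepsilon)_\varepsilon$ and $(P_\varepsilon)_\varepsilon$ and a moderate net $(\lambda'_\varepsilon)_\varepsilon$ such that $\widetilde{Q_\varepsilon}(\xi,t)\le\lambda'_\varepsilon\widetilde{P_\varepsilon}(\xi,t)$ for all $\xi\in\mathbb{R}^n$, all $\varepsilon\in(0,1]$ and all $t\ge1$.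
   Context: Nets are indexed by $\varepsilon\in(0,1]$. A net $(\lambda_\varepsilon)_\varepsilon$ of complex numbers is moderate if $|\lambda_\varepsilon|=O(\varepsilon^{-N})$ as $\varepsilon\to0$ for some $N\in\mathbb{N}$, negligible if $|\lambda_\varepsilon|=O(\varepsilon^q)$ for all $q\in\mathbb{N}$. $\widetilde{\mathbb{C}}$ is the ring of moderate nets modulo negligible nets. A differential operator with constant coefficients in $\widetilde{\mathbb{C}}$ is $P(D)=\sum_{|\alpha|\le m}c_\alpha D^\alpha$ on $\mathbb{R}^n$, $c_\alpha\in\widetilde{\mathbb{C}}$, $D=-i\partial$, with polynomial $P(\xi)=\sum_{|\alpha|\le m}c_\alpha\xi^\alpha$. A representative of $P$ is a net of polynomials $P_\varepsilon(\xi)=\sum_{|\alpha|\le m}c_{\alpha,\varepsilon}\xi^\alpha$ with $(c_{\alpha,\varepsilon})_\varepsilon$ a representative of $c_\alpha$. For a polynomial $Q$ and $t>0$, $\widetilde Q(\xi,t)=(\sum_\alpha|\partial^\alpha Q(\xi)|^2t^{2|\alpha|})^{1/2}$ and $\widetilde Q(\xi)=\widetilde Q(\xi,1)$. $Q(D)\prec P(D)$ ($P(D)$ is stronger than $Q(D)$) means: there exist representatives $(P_\varepsilon)_\varepsilon$, $(Q_\varepsilon)_\varepsilon$ and a moderate net $(\lambda_\varepsilon)_\varepsilon$ with $\widetilde{Q_\varepsilon}(\xi)\le\lambda_\varepsilon\widetilde{P_\varepsilon}(\xi)$ for all $\xi\in\mathbb{R}^n$, $\varepsilon\in(0,1]$.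 *)

theory Defs
  imports "HOL-Analysis.Analysis" "HOL-Library.Poly_Mapping" "HOL-Library.Landau_Symbols"
begin

section \<open>Generalized complex numbers\<close>

text \<open>
  A net indexed by \<open>(0,1]\<close> is a function on \<^typ>\<open>real\<close> whose values outside \<open>{0<..1}\<close> are
  irrelevant; the asymptotics below only see \<open>\<epsilon> \<rightarrow> 0\<close> from the right.
\<close>

definition moderate :: "(real \<Rightarrow> 'a::real_normed_vector) \<Rightarrow> bool" where
  "moderate u \<longleftrightarrow> (\<exists>N::nat. (\<lambda>\<epsilon>. norm (u \<epsilon>)) \<in> O[at_right 0](\<lambda>\<epsilon>. inverse (\<epsilon> ^ N)))"

definition negligible_net :: "(real \<Rightarrow> 'a::real_normed_vector) \<Rightarrow> bool" where
  "negligible_net u \<longleftrightarrow> (\<forall>q::nat. (\<lambda>\<epsilon>. norm (u \<epsilon>)) \<in> O[at_right 0](\<lambda>\<epsilon>. \<epsilon> ^ q))"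

lemma norm_net_le_bigo:
  assumes "\<And>\<epsilon>. norm (u \<epsilon>) \<le> f \<epsilon>" "f \<in> O[at_right 0](g :: real \<Rightarrow> real)"
  shows "(\<lambda>\<epsilon>. norm (u \<epsilon>)) \<in> O[at_right 0](g)"
proof (rule landau_o.big_trans[OF _ assms(2)])
  show "(\<lambda>\<epsilon>. norm (u \<epsilon>)) \<in> O[at_right 0](f)"
    by (rule landau_o.big_mono, rule always_eventually)
       (use assms(1) order_trans[OF assms(1) abs_ge_self] in auto)
qed

lemma power_bigo_at_right:
  assumes "N \<le> M"
  shows "(\<lambda>\<epsilon>::real. inverse (\<epsilon> ^ N)) \<in> O[at_right 0](\<lambda>\<epsilon>. inverse (\<epsilon> ^ M))"
proof (rule landau_o.big_mono)
  have "eventually (\<lambda>\<epsilon>::real. \<epsilon> \<in> {0<..<1}) (at_right 0)"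
    by (rule eventually_at_right_real) simp
  then show "eventually (\<lambda>\<epsilon>::real. norm (inverse (\<epsilon> ^ N)) \<le> norm (inverse (\<epsilon> ^ M))) (at_right 0)"
    by eventually_elim (use assms in \<open>auto intro!: le_imp_inverse_le power_decreasing\<close>)
qed

lemma moderate_add:
  assumes "moderate u" "moderate v"
  shows "moderate (\<lambda>\<epsilon>. u \<epsilon> + v \<epsilon>)"
proof -
  from assms obtain N M where
    *: "(\<lambda>\<epsilon>. norm (u \<epsilon>)) \<in> O[at_right 0](\<lambda>\<epsilon>. inverse (\<epsilon> ^ N))"
       "(\<lambda>\<epsilon>. norm (v \<epsilon>)) \<in> O[at_right 0](\<lambda>\<epsilon>. inverse (\<epsilon> ^ M))"
    unfolding moderate_def by blast
  have "(\<lambda>\<epsilon>. norm (u \<epsilon>)) \<in> O[at_right 0](\<lambda>\<epsilon>. inverse (\<epsilon> ^ max N M))"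
       "(\<lambda>\<epsilon>. norm (v \<epsilon>)) \<in> O[at_right 0](\<lambda>\<epsilon>. inverse (\<epsilon> ^ max N M))"
    by (rule landau_o.big_trans[OF *(1)] landau_o.big_trans[OF *(2)], rule power_bigo_at_right, simp)+
  then have "(\<lambda>\<epsilon>. norm (u \<epsilon>) + norm (v \<epsilon>)) \<in> O[at_right 0](\<lambda>\<epsilon>. inverse (\<epsilon> ^ max N M))"
    by (rule sum_in_bigo)
  then have "(\<lambda>\<epsilon>. norm (u \<epsilon> + v \<epsilon>)) \<in> O[at_right 0](\<lambda>\<epsilon>. inverse (\<epsilon> ^ max N M))"
    by (rule norm_net_le_bigo[rotated]) (rule norm_triangle_ineq)
  then show ?thesis
    unfolding moderate_def by blast
qed

lemma moderate_uminus: "moderate u \<Longrightarrow> moderate (\<lambda>\<epsilon>. - u \<epsilon>)"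
  by (simp add: moderate_def)

lemma moderate_mult:
  fixes u v :: "real \<Rightarrow> 'a::real_normed_algebra"
  assumes "moderate u" "moderate v"
  shows "moderate (\<lambda>\<epsilon>. u \<epsilon> * v \<epsilon>)"
proof -
  from assms obtain N M where
    *: "(\<lambda>\<epsilon>. norm (u \<epsilon>)) \<in> O[at_right 0](\<lambda>\<epsilon>. inverse (\<epsilon> ^ N))"
       "(\<lambda>\<epsilon>. norm (v \<epsilon>)) \<in> O[at_right 0](\<lambda>\<epsilon>. inverse (\<epsilon> ^ M))"
    unfolding moderate_def by blast
  from landau_o.big.mult[OF *]
  have "(\<lambda>\<epsilon>. norm (u \<epsilon>) * norm (v \<epsilon>)) \<in> O[at_right 0](\<lambda>\<epsilon>. inverse (\<epsilon> ^ (N + M)))"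
    by (simp add: power_add mult.commute)
  then have "(\<lambda>\<epsilon>. norm (u \<epsilon> * v \<epsilon>)) \<in> O[at_right 0](\<lambda>\<epsilon>. inverse (\<epsilon> ^ (N + M)))"
    by (rule norm_net_le_bigo[rotated]) (rule norm_mult_ineq)
  then show ?thesis
    unfolding moderate_def by blast
qed

lemma moderate_const: "moderate (\<lambda>_. c)"
  unfolding moderate_def by (rule exI[of _ 0]) simp

lemma negligible_net_add:
  assumes "negligible_net u" "negligible_net v"
  shows "negligible_net (\<lambda>\<epsilon>. u \<epsilon> + v \<epsilon>)"
  unfolding negligible_net_def
proof
  fix q :: nat
  have "(\<lambda>\<epsilon>. norm (u \<epsilon>) + norm (v \<epsilon>)) \<in> O[at_right 0](\<lambda>\<epsilon>. \<epsilon> ^ q)"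
    using assms by (intro sum_in_bigo) (auto simp: negligible_net_def)
  then show "(\<lambda>\<epsilon>. norm (u \<epsilon> + v \<epsilon>)) \<in> O[at_right 0](\<lambda>\<epsilon>. \<epsilon> ^ q)"
    by (rule norm_net_le_bigo[rotated]) (rule norm_triangle_ineq)
qed

lemma negligible_net_uminus: "negligible_net u \<Longrightarrow> negligible_net (\<lambda>\<epsilon>. - u \<epsilon>)"
  by (simp add: negligible_net_def)

lemma negligible_net_mult:
  fixes u v :: "real \<Rightarrow> 'a::real_normed_algebra"
  assumes "moderate u" "negligible_net v"
  shows "negligible_net (\<lambda>\<epsilon>. u \<epsilon> * v \<epsilon>)" "negligible_net (\<lambda>\<epsilon>. v \<epsilon> * u \<epsilon>)"
proof -
  from assms obtain N where
    N: "(\<lambda>\<epsilon>. norm (u \<epsilon>)) \<in> O[at_right 0](\<lambda>\<epsilon>. inverse (\<epsilon> ^ N))"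
    unfolding moderate_def by blast
  have *: "(\<lambda>\<epsilon>. norm (u \<epsilon>) * norm (v \<epsilon>)) \<in> O[at_right 0](\<lambda>\<epsilon>. \<epsilon> ^ q)" for q
  proof -
    have "(\<lambda>\<epsilon>. norm (v \<epsilon>)) \<in> O[at_right 0](\<lambda>\<epsilon>. \<epsilon> ^ (N + q))"
      using assms by (simp add: negligible_net_def)
    from landau_o.big.mult[OF N this]
    have "(\<lambda>\<epsilon>. norm (u \<epsilon>) * norm (v \<epsilon>)) \<in> O[at_right 0](\<lambda>\<epsilon>. inverse (\<epsilon> ^ N) * \<epsilon> ^ (N + q))" .
    also have "eventually (\<lambda>\<epsilon>::real. inverse (\<epsilon> ^ N) * \<epsilon> ^ (N + q) = \<epsilon> ^ q) (at_right 0)"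
      using eventually_at_right_less[of "0::real"]
      by eventually_elim (simp add: power_add field_simps)
    then have "O[at_right 0](\<lambda>\<epsilon>::real. inverse (\<epsilon> ^ N) * \<epsilon> ^ (N + q)) = O[at_right 0](\<lambda>\<epsilon>. \<epsilon> ^ q)"
      by (rule landau_o.big.cong)
    finally show ?thesis .
  qed
  show "negligible_net (\<lambda>\<epsilon>. u \<epsilon> * v \<epsilon>)" "negligible_net (\<lambda>\<epsilon>. v \<epsilon> * u \<epsilon>)"
    unfolding negligible_net_def
    by (intro allI norm_net_le_bigo[OF _ *] norm_mult_ineq,
        intro allI norm_net_le_bigo[OF _ *], subst mult.commute, rule norm_mult_ineq)
qed

lemma negligible_net_zero: "negligible_net (\<lambda>_. 0)"
  by (simp add: negligible_net_def)

definition net_eq :: "(real \<Rightarrow> complex) \<Rightarrow> (real \<Rightarrow> complex) \<Rightarrow> bool" where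
  "net_eq u v \<longleftrightarrow> moderate u \<and> moderate v \<and> negligible_net (\<lambda>\<epsilon>. u \<epsilon> - v \<epsilon>)"

lemma net_eq_refl: "net_eq u u \<longleftrightarrow> moderate u"
  by (simp add: net_eq_def negligible_net_zero)

lemma part_equivp_net_eq: "part_equivp net_eq"
proof (rule part_equivpI)
  show "\<exists>u. net_eq u u"
    using moderate_const[of "0::complex"] net_eq_refl by blast
  show "symp net_eq"
    by (rule sympI) (auto simp: net_eq_def dest: negligible_net_uminus)
  show "transp net_eq"
    by (rule transpI) (auto simp: net_eq_def dest: negligible_net_add)
qed

quotient_type gcomplex = "real \<Rightarrow> complex" / partial: net_eq
  by (rule part_equivp_net_eq)

instantiation gcomplex :: comm_ring_1
begin

lift_definition zero_gcomplex :: gcomplex is "\<lambda>_. 0"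
  by (simp add: net_eq_refl moderate_const)

lift_definition one_gcomplex :: gcomplex is "\<lambda>_. 1"
  by (simp add: net_eq_refl moderate_const)

lift_definition plus_gcomplex :: "gcomplex \<Rightarrow> gcomplex \<Rightarrow> gcomplex" is "\<lambda>u v \<epsilon>. u \<epsilon> + v \<epsilon>"
proof -
  fix u u' v v' :: "real \<Rightarrow> complex"
  assume *: "net_eq u u'" "net_eq v v'"
  have "negligible_net (\<lambda>\<epsilon>. (u \<epsilon> - u' \<epsilon>) + (v \<epsilon> - v' \<epsilon>))"
    using * by (intro negligible_net_add) (auto simp: net_eq_def)
  then show "net_eq (\<lambda>\<epsilon>. u \<epsilon> + v \<epsilon>) (\<lambda>\<epsilon>. u' \<epsilon> + v' \<epsilon>)"
    using * by (auto simp: net_eq_def moderate_add algebra_simps)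
qed

lift_definition uminus_gcomplex :: "gcomplex \<Rightarrow> gcomplex" is "\<lambda>u \<epsilon>. - u \<epsilon>"
  unfolding net_eq_def
  by (auto intro: moderate_uminus dest: negligible_net_uminus)

lift_definition times_gcomplex :: "gcomplex \<Rightarrow> gcomplex \<Rightarrow> gcomplex" is "\<lambda>u v \<epsilon>. u \<epsilon> * v \<epsilon>"
proof -
  fix u u' v v' :: "real \<Rightarrow> complex"
  assume *: "net_eq u u'" "net_eq v v'"
  have "negligible_net (\<lambda>\<epsilon>. u \<epsilon> * (v \<epsilon> - v' \<epsilon>) + (u \<epsilon> - u' \<epsilon>) * v' \<epsilon>)"
    using * by (intro negligible_net_add negligible_net_mult) (auto simp: net_eq_def)
  then show "net_eq (\<lambda>\<epsilon>. u \<epsilon> * v \<epsilon>) (\<lambda>\<epsilon>. u' \<epsilon> * v' \<epsilon>)"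
    using * by (auto simp: net_eq_def moderate_mult algebra_simps)
qed

definition minus_gcomplex :: "gcomplex \<Rightarrow> gcomplex \<Rightarrow> gcomplex" where
  "minus_gcomplex a b = a + (- b)"

instance
proof
  fix a b c :: gcomplex
  show "a + b + c = a + (b + c)"
    by transfer (simp add: net_eq_def negligible_net_zero moderate_add add.assoc)
  show "a + b = b + a"
    by transfer (simp add: net_eq_def negligible_net_zero moderate_add add.commute)
  show "0 + a = a"
    by transfer (simp add: net_eq_def negligible_net_zero)
  show "- a + a = 0"
    by transfer (simp add: net_eq_def negligible_net_zero moderate_const)
  show "a - b = a + - b"
    by (simp add: minus_gcomplex_def)
  show "a * b * c = a * (b * c)"
    by transfer (simp add: net_eq_def negligible_net_zero moderate_mult mult.assoc)
  show "a * b = b * a"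
    by transfer (simp add: net_eq_def negligible_net_zero moderate_mult mult.commute)
  show "1 * a = a"
    by transfer (simp add: net_eq_def negligible_net_zero)
  show "(a + b) * c = a * c + b * c"
    by transfer (simp add: net_eq_def negligible_net_zero moderate_mult moderate_add distrib_right)
  show "(0::gcomplex) \<noteq> 1"
  proof transfer
    have "\<not> negligible_net (\<lambda>_. - 1 :: complex)"
    proof
      assume "negligible_net (\<lambda>_. - 1 :: complex)"
      then have "(\<lambda>_. 1::real) \<in> O[at_right 0](\<lambda>\<epsilon>. \<epsilon> ^ 1)"
        unfolding negligible_net_def by (metis norm_minus_cancel norm_one)
      then obtain C where C: "C > 0" "eventually (\<lambda>\<epsilon>::real. norm (1::real) \<le> C * norm (\<epsilon> ^ 1)) (at_right 0)"
        by (rule landau_o.bigE)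
      have small: "eventually (\<lambda>\<epsilon>::real. \<epsilon> \<in> {0<..<1/C}) (at_right 0)"
        by (rule eventually_at_right_real) (use C(1) in simp)
      have "eventually (\<lambda>_::real. False) (at_right 0)"
        by (rule eventually_mono[OF eventually_conj[OF C(2) small]])
           (use C(1) in \<open>auto simp: field_simps\<close>)
      then show False
        by simp
    qed
    then show "\<not> net_eq (\<lambda>_. 0) (\<lambda>_. 1)"
      by (simp add: net_eq_def)
  qed
qed

end

definition represents :: "(real \<Rightarrow> complex) \<Rightarrow> gcomplex \<Rightarrow> bool" where
  "represents u c \<longleftrightarrow> moderate u \<and> abs_gcomplex u = c"

lemma represents_iff: "represents u (abs_gcomplex v) \<longleftrightarrow> net_eq u v" if "moderate v"
  using that Quotient_rel[OF Quotient_gcomplex, of u v]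
  by (auto simp: represents_def net_eq_refl)

section \<open>Polynomials in several variables\<close>

text \<open>
  Multi-indices on \<open>\<real>\<^sup>n\<close> are vectors of type \<^typ>\<open>nat ^ 'n\<close>; a polynomial in \<open>n\<close> variables is the
  finitely supported family of its coefficients.
\<close>

type_synonym ('a, 'n) mpoly = "(nat ^ 'n) \<Rightarrow>\<^sub>0 'a"

definition mlength :: "nat ^ 'n::finite \<Rightarrow> nat" where
  "mlength \<alpha> = (\<Sum>i\<in>UNIV. \<alpha> $ i)"

definition degree_le :: "('a::zero, 'n::finite) mpoly \<Rightarrow> nat \<Rightarrow> bool" where
  "degree_le p m \<longleftrightarrow> (\<forall>\<alpha>. Poly_Mapping.lookup p \<alpha> \<noteq> 0 \<longrightarrow> mlength \<alpha> \<le> m)"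

definition meval :: "(complex, 'n::finite) mpoly \<Rightarrow> real ^ 'n \<Rightarrow> complex" where
  "meval p \<xi> = (\<Sum>\<alpha>\<in>Poly_Mapping.keys p. Poly_Mapping.lookup p \<alpha> * (\<Prod>i\<in>UNIV. complex_of_real (\<xi> $ i) ^ (\<alpha> $ i)))"

text \<open>
  The iterated partial derivative \<open>\<partial>\<^sup>\<alpha>\<close> on coefficients, from
  \<open>\<partial>\<^sup>\<alpha> \<xi>\<^sup>\<alpha>\<^sup>+\<^sup>\<beta> = ((\<alpha> + \<beta>)! / \<beta>!) \<xi>\<^sup>\<beta>\<close>.
\<close>

lift_definition mderiv :: "nat ^ 'n::finite \<Rightarrow> (complex, 'n) mpoly \<Rightarrow> (complex, 'n) mpoly"
  is "\<lambda>\<alpha> c \<beta>. (\<Prod>i\<in>UNIV. fact (\<alpha> $ i + \<beta> $ i) / fact (\<beta> $ i)) * c (\<alpha> + \<beta>)"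
proof -
  fix \<alpha> :: "nat ^ 'n" and c :: "nat ^ 'n \<Rightarrow> complex"
  assume "finite {\<beta>. c \<beta> \<noteq> 0}"
  then have "finite ((\<lambda>\<beta>. \<alpha> + \<beta>) -` {\<beta>. c \<beta> \<noteq> 0})"
    by (rule finite_vimageI) (simp add: inj_def)
  then show "finite {\<beta>. (\<Prod>i\<in>UNIV. fact (\<alpha> $ i + \<beta> $ i) / fact (\<beta> $ i)) * c (\<alpha> + \<beta>) \<noteq> 0}"
    by (rule finite_subset[rotated]) auto
qed

lemma mderiv_0: "mderiv 0 p = p"
  by (rule poly_mapping_eqI) (simp add: mderiv.rep_eq)

lemma mderiv_add: "mderiv (\<alpha> + \<beta>) p = mderiv \<alpha> (mderiv \<beta> p)"
proof (rule poly_mapping_eqI)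
  fix \<gamma>
  have "(\<Prod>i\<in>UNIV. fact (\<alpha> $ i + \<beta> $ i + \<gamma> $ i) / fact (\<gamma> $ i) :: complex) =
    (\<Prod>i\<in>UNIV. fact (\<alpha> $ i + \<gamma> $ i) / fact (\<gamma> $ i)) *
    (\<Prod>i\<in>UNIV. fact (\<beta> $ i + (\<alpha> $ i + \<gamma> $ i)) / fact (\<alpha> $ i + \<gamma> $ i))"
    by (simp add: prod.distrib[symmetric] ac_simps)
  then show "Poly_Mapping.lookup (mderiv (\<alpha> + \<beta>) p) \<gamma> = Poly_Mapping.lookup (mderiv \<alpha> (mderiv \<beta> p)) \<gamma>"
    by (simp add: mderiv.rep_eq ac_simps)
qed

lemma meval_mderiv_axis:
  fixes p :: "(complex, 'n::finite) mpoly"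
  shows "((\<lambda>s. meval p (\<xi> + s *\<^sub>R axis j 1)) has_vector_derivative meval (mderiv (axis j 1) p) \<xi>) (at 0)"
proof -
  define M where "M \<alpha> = (\<Prod>i\<in>UNIV - {j}. complex_of_real (\<xi> $ i) ^ (\<alpha> $ i))" for \<alpha> :: "nat ^ 'n"
  define d where "d \<alpha> = Poly_Mapping.lookup p \<alpha> * (of_nat (\<alpha> $ j) * complex_of_real (\<xi> $ j) ^ (\<alpha> $ j - 1) * M \<alpha>)"
    for \<alpha>
  define e :: "nat ^ 'n" where "e = axis j 1"
  have split: "(\<Prod>i\<in>UNIV. complex_of_real ((\<xi> + s *\<^sub>R axis j 1) $ i) ^ (\<alpha> $ i)) =
      (complex_of_real (\<xi> $ j) + complex_of_real s) ^ (\<alpha> $ j) * M \<alpha>" for s and \<alpha> :: "nat ^ 'n"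
    by (subst prod.remove[of _ j]) (auto simp: M_def axis_def intro!: prod.cong)
  have "((\<lambda>s. meval p (\<xi> + s *\<^sub>R axis j 1)) has_vector_derivative (\<Sum>\<alpha>\<in>Poly_Mapping.keys p. d \<alpha>)) (at 0)"
    unfolding meval_def split d_def
    by (rule has_vector_derivative_real_field[where f = "\<lambda>z. \<Sum>\<alpha>\<in>Poly_Mapping.keys p.
          Poly_Mapping.lookup p \<alpha> * ((complex_of_real (\<xi> $ j) + z) ^ (\<alpha> $ j) * M \<alpha>)"])
       (auto intro!: derivative_eq_intros sum.cong)
  also have "(\<Sum>\<alpha>\<in>Poly_Mapping.keys p. d \<alpha>) = (\<Sum>\<alpha>\<in>{\<alpha>\<in>Poly_Mapping.keys p. \<alpha> $ j \<noteq> 0}. d \<alpha>)"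
    by (rule sum.mono_neutral_right) (auto simp: d_def)
  also have "\<dots> = (\<Sum>\<beta>\<in>Poly_Mapping.keys (mderiv e p). d (e + \<beta>))"
  proof (rule sum.reindex_bij_witness[of _ "\<lambda>\<beta>. e + \<beta>" "\<lambda>\<alpha>. \<alpha> - e"])
    fix \<alpha> assume \<alpha>: "\<alpha> \<in> {\<alpha>\<in>Poly_Mapping.keys p. \<alpha> $ j \<noteq> 0}"
    then show *: "e + (\<alpha> - e) = \<alpha>"
      by (auto simp: vec_eq_iff e_def axis_def)
    then show "\<alpha> - e \<in> Poly_Mapping.keys (mderiv e p)"
      using \<alpha> by (auto simp: in_keys_iff mderiv.rep_eq)
    show "d (e + (\<alpha> - e)) = d \<alpha>"
      using * by simp
  next
    fix \<beta> assume "\<beta> \<in> Poly_Mapping.keys (mderiv e p)"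
    then show "e + \<beta> \<in> {\<alpha>\<in>Poly_Mapping.keys p. \<alpha> $ j \<noteq> 0}"
      by (auto simp: in_keys_iff mderiv.rep_eq e_def)
    show "e + \<beta> - e = \<beta>"
      by (simp add: vec_eq_iff)
  qed
  also have "\<dots> = meval (mderiv e p) \<xi>"
    unfolding meval_def
  proof (rule sum.cong[OF refl])
    fix \<beta>
    have "(\<Prod>i\<in>UNIV. fact (e $ i + \<beta> $ i) / fact (\<beta> $ i) :: complex) = of_nat (Suc (\<beta> $ j))"
      by (subst prod.remove[of _ j]) (auto simp: e_def axis_def intro!: prod.neutral)
    moreover have "M (e + \<beta>) = M \<beta>"
      unfolding M_def by (rule prod.cong) (auto simp: e_def axis_def)
    moreover have "(\<Prod>i\<in>UNIV. complex_of_real (\<xi> $ i) ^ (\<beta> $ i)) = complex_of_real (\<xi> $ j) ^ (\<beta> $ j) * M \<beta>"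
      using split[of 0 \<beta>] by simp
    ultimately show "d (e + \<beta>) = Poly_Mapping.lookup (mderiv e p) \<beta> * (\<Prod>i\<in>UNIV. complex_of_real (\<xi> $ i) ^ (\<beta> $ i))"
      by (simp add: d_def mderiv.rep_eq) (simp add: e_def)
  qed
  finally show ?thesis
    by (simp add: e_def)
qed

text \<open>
  The sum in \<open>(\<Sum>\<^sub>\<alpha> |\<partial>\<^sup>\<alpha>q(\<xi>)|\<^sup>2 t\<^sup>2\<^sup>|\<^sup>\<alpha>\<^sup>|)\<^sup>1\<^sup>/\<^sup>2\<close> is over all multi-indices; only finitely many terms are
  nonzero.
\<close>

definition mtilde :: "(complex, 'n::finite) mpoly \<Rightarrow> real ^ 'n \<Rightarrow> real \<Rightarrow> real" where
  "mtilde q \<xi> t = sqrt (Sum_any (\<lambda>\<alpha>. (cmod (meval (mderiv \<alpha> q) \<xi>))\<^sup>2 * t ^ (2 * mlength \<alpha>)))"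

lemma finite_mlength_le: "finite {\<alpha> :: nat ^ 'n::finite. mlength \<alpha> \<le> m}"
proof -
  have "{\<alpha> :: nat ^ 'n. mlength \<alpha> \<le> m} \<subseteq> vec_lambda ` (PiE UNIV (\<lambda>_. {..m}))"
  proof
    fix \<alpha> :: "nat ^ 'n"
    assume "\<alpha> \<in> {\<alpha>. mlength \<alpha> \<le> m}"
    then have "\<alpha> $ i \<le> m" for i
      using member_le_sum[of i UNIV "\<lambda>i. \<alpha> $ i"] by (auto simp: mlength_def)
    then have "vec_nth \<alpha> \<in> PiE UNIV (\<lambda>_. {..m})"
      by auto
    then show "\<alpha> \<in> vec_lambda ` (PiE UNIV (\<lambda>_. {..m}))"
      by (metis image_eqI vec_lambda_eta)
  qed
  then show ?thesis
    by (rule finite_subset) (intro finite_imageI finite_PiE, auto)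
qed

lemma mderiv_eq_0:
  assumes "degree_le q m" "mlength \<alpha> > m"
  shows "mderiv \<alpha> q = 0"
proof (rule poly_mapping_eqI)
  fix \<beta>
  have "mlength (\<alpha> + \<beta>) > m"
    using assms(2) by (simp add: mlength_def sum.distrib)
  then have "Poly_Mapping.lookup q (\<alpha> + \<beta>) = 0"
    using assms(1) unfolding degree_le_def by (meson not_le)
  then show "Poly_Mapping.lookup (mderiv \<alpha> q) \<beta> = Poly_Mapping.lookup 0 \<beta>"
    by (simp add: mderiv.rep_eq)
qed

lemma mtilde_eq_sum:
  assumes "degree_le q m"
  shows "mtilde q \<xi> t =
    sqrt (\<Sum>\<alpha> | mlength \<alpha> \<le> m. (cmod (meval (mderiv \<alpha> q) \<xi>))\<^sup>2 * t ^ (2 * mlength \<alpha>))"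
  unfolding mtilde_def
proof (subst Sum_any.expand_superset[OF finite_mlength_le[of m]])
  have "meval (mderiv \<alpha> q) \<xi> = 0" if "\<not> mlength \<alpha> \<le> m" for \<alpha>
    using mderiv_eq_0[OF assms] that by (simp add: meval_def)
  then show "{\<alpha>. (cmod (meval (mderiv \<alpha> q) \<xi>))\<^sup>2 * t ^ (2 * mlength \<alpha>) \<noteq> 0} \<subseteq> {\<alpha>. mlength \<alpha> \<le> m}"
    by auto
qed simp

section \<open>Operators with constant generalized coefficients\<close>

text \<open>
  The operator \<open>P(D) = \<Sum>\<^bsub>|\<alpha>| \<le> m\<^esub> c\<^sub>\<alpha> D\<^sup>\<alpha>\<close> is given by the bound \<open>m\<close> and the polynomial
  \<open>P(\<xi>) = \<Sum>\<^bsub>|\<alpha>| \<le> m\<^esub> c\<^sub>\<alpha> \<xi>\<^sup>\<alpha>\<close>. The bound matters for representatives: each \<open>P\<^sub>\<epsilon>\<close> contains only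
  monomials with \<open>|\<alpha>| \<le> m\<close>, whereas some \<open>c\<^sub>\<alpha>\<close> with \<open>|\<alpha>| \<le> m\<close> may vanish.
\<close>

definition representative ::
  "nat \<Rightarrow> (gcomplex, 'n::finite) mpoly \<Rightarrow> (real \<Rightarrow> (complex, 'n) mpoly) \<Rightarrow> bool" where
  "representative m P p \<longleftrightarrow>
     (\<forall>\<epsilon>\<in>{0<..1}. degree_le (p \<epsilon>) m) \<and>
     (\<forall>\<alpha>. mlength \<alpha> \<le> m \<longrightarrow> represents (\<lambda>\<epsilon>. Poly_Mapping.lookup (p \<epsilon>) \<alpha>) (Poly_Mapping.lookup P \<alpha>))"

text \<open>\<open>weaker k Q m P\<close> is \<open>Q(D) \<prec> P(D)\<close> (\<open>P(D)\<close> is stronger than \<open>Q(D)\<close>), with \<open>Q\<close> and \<open>P\<close> of order at most \<open>k\<close> and \<open>m\<close>.\<close>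

definition weaker ::
  "nat \<Rightarrow> (gcomplex, 'n::finite) mpoly \<Rightarrow> nat \<Rightarrow> (gcomplex, 'n) mpoly \<Rightarrow> bool" where
  "weaker k Q m P \<longleftrightarrow>
     (\<exists>p q (l :: real \<Rightarrow> real). representative m P p \<and> representative k Q q \<and> moderate l \<and>
        (\<forall>\<xi>. \<forall>\<epsilon>\<in>{0<..1}. mtilde (q \<epsilon>) \<xi> 1 \<le> l \<epsilon> * mtilde (p \<epsilon>) \<xi> 1))"

end

theory Submission
  imports Defs "HOL-Computational_Algebra.Polynomial"
begin

text \<open>
  Only the implication from the pointwise bound to the bound for all \<open>t \<ge> 1\<close> has content, and it
  holds for each fixed \<open>\<epsilon>\<close> with a constant depending only on the dimension and the orders. By
  Taylor's formula, \<open>p~(\<xi> + \<eta>, t) \<le> K p~(\<xi>, t)\<close> if all \<open>|\<eta>\<^sub>i| \<le> t\<close>, so \<open>q\<close> is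
  bounded by \<open>K C p~(\<xi>, t)\<close> on the cube of radius \<open>t\<close> around \<open>\<xi>\<close>. The
  coefficients \<open>t\<^bsup>|\<alpha>|\<^esup> \<partial>\<^sup>\<alpha>q(\<xi>) / \<alpha>!\<close> of the polynomial \<open>\<eta> \<mapsto> q(\<xi> + t \<eta>)\<close> are, by
  Lagrange interpolation, fixed linear combinations of its values on a finite grid in the unit cube.
\<close>

section \<open>Powers and factorials of multi-indices\<close>

definition mpow :: "real ^ 'n::finite \<Rightarrow> nat ^ 'n \<Rightarrow> real" where
  "mpow x \<alpha> = (\<Prod>i\<in>UNIV. x $ i ^ (\<alpha> $ i))"

definition mfact :: "nat ^ 'n::finite \<Rightarrow> real" where
  "mfact \<alpha> = (\<Prod>i\<in>UNIV. fact (\<alpha> $ i))"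

lemma mfact_pos: "mfact \<alpha> > 0"
  by (simp add: mfact_def prod_pos)

lemma mfact_ge_1: "mfact \<alpha> \<ge> 1"
  unfolding mfact_def by (rule prod_ge_1) (rule fact_ge_1)

lemma mlength_add: "mlength (\<alpha> + \<beta>) = mlength \<alpha> + mlength \<beta>"
  by (simp add: mlength_def sum.distrib)

lemma nth_le_mlength: "\<alpha> $ i \<le> mlength \<alpha>"
  using member_le_sum[of i UNIV "\<lambda>i. \<alpha> $ i"] by (auto simp: mlength_def)

lemma mpow_scaleR: "mpow (t *\<^sub>R x) \<alpha> = t ^ mlength \<alpha> * mpow x \<alpha>"
  by (simp add: mpow_def mlength_def power_mult_distrib prod.distrib power_sum)

lemma abs_mpow_le:
  assumes "\<And>i. \<bar>x $ i\<bar> \<le> t"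
  shows "\<bar>mpow x \<alpha>\<bar> \<le> t ^ mlength \<alpha>"
  unfolding mpow_def mlength_def power_sum abs_prod power_abs
  by (rule prod_mono) (auto intro: power_mono assms)

text \<open>Trades the support of \<open>p\<close> for an index set fixed by the order alone, so
  that sums belonging to different polynomials can be compared and interchanged.\<close>

lemma meval_eq_sum:
  assumes "degree_le p m"
  shows "meval p \<xi> = (\<Sum>\<alpha> | mlength \<alpha> \<le> m. Poly_Mapping.lookup p \<alpha> * of_real (mpow \<xi> \<alpha>))"
proof -
  have "Poly_Mapping.keys p \<subseteq> {\<alpha>. mlength \<alpha> \<le> m}"
    using assms by (auto simp: degree_le_def in_keys_iff)
  then show ?thesis
    unfolding meval_def mpow_def of_real_prod of_real_power
    by (intro sum.mono_neutral_left finite_mlength_le) (auto simp: in_keys_iff)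
qed

text \<open>The bound is not lowered to \<open>m - mlength \<alpha>\<close>: with the crude bound,
  \<open>p\<close> and all its derivatives share one index set.\<close>

lemma degree_le_mderiv:
  assumes "degree_le p m"
  shows "degree_le (mderiv \<alpha> p) m"
  unfolding degree_le_def
proof (intro allI impI)
  fix \<beta> assume "Poly_Mapping.lookup (mderiv \<alpha> p) \<beta> \<noteq> 0"
  then have "Poly_Mapping.lookup p (\<alpha> + \<beta>) \<noteq> 0"
    by (auto simp: mderiv.rep_eq)
  then have "mlength (\<alpha> + \<beta>) \<le> m"
    using assms by (simp add: degree_le_def)
  then show "mlength \<beta> \<le> m"
    by (simp add: mlength_add)
qed

section \<open>Taylor's formula in several variables\<close>

text \<open>The binomial theorem in each coordinate, multiplied out. Summing over pairs with a given
  sum prepares the regrouping by \<beta> in Taylor's formula.\<close>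

lemma mpow_add_eq_sum:
  "mpow (\<xi> + \<eta>) \<gamma> = (\<Sum>(\<beta>, \<delta>) | \<beta> + \<delta> = \<gamma>.
     mfact \<gamma> / (mfact \<beta> * mfact \<delta>) * mpow \<xi> \<delta> * mpow \<eta> \<beta>)"
proof -
  have "mpow (\<xi> + \<eta>) \<gamma> = (\<Prod>i\<in>UNIV. \<Sum>b\<le>\<gamma> $ i. of_nat (\<gamma> $ i choose b) * \<eta> $ i ^ b * \<xi> $ i ^ (\<gamma> $ i - b))"
    unfolding mpow_def
    by (rule prod.cong) (simp_all add: binomial_ring[of "\<eta> $ _" "\<xi> $ _", symmetric] add.commute)
  also have "\<dots> = (\<Sum>g\<in>PiE UNIV (\<lambda>i. {..\<gamma> $ i}). \<Prod>i\<in>UNIV.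
      of_nat (\<gamma> $ i choose g i) * \<eta> $ i ^ g i * \<xi> $ i ^ (\<gamma> $ i - g i))"
    by (rule prod_sum_PiE) auto
  also have "\<dots> = (\<Sum>(\<beta>, \<delta>) | \<beta> + \<delta> = \<gamma>. mfact \<gamma> / (mfact \<beta> * mfact \<delta>) * mpow \<xi> \<delta> * mpow \<eta> \<beta>)"
  \<comment> \<open>Choosing the exponent \<open>g i\<close> of \<open>\<eta> $ i\<close> in every
    coordinate amounts to choosing \<beta>; then \<delta> is the rest of \<gamma>, and truncated
    subtraction is exact because \<open>g i \<le> \<gamma> $ i\<close>.\<close>
  proof (rule sum.reindex_bij_witness[of _ "\<lambda>(\<beta>, \<delta>). vec_nth \<beta>" "\<lambda>g. (vec_lambda g, \<gamma> - vec_lambda g)"])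
    fix g assume "g \<in> PiE UNIV (\<lambda>i. {..\<gamma> $ i})"
    then have g: "g i \<le> \<gamma> $ i" for i
      by auto
    then show "(vec_lambda g, \<gamma> - vec_lambda g) \<in> {(\<beta>, \<delta>). \<beta> + \<delta> = \<gamma>}"
      by (simp add: vec_eq_iff)
    show "(case (vec_lambda g, \<gamma> - vec_lambda g) of (\<beta>, \<delta>) \<Rightarrow>
        mfact \<gamma> / (mfact \<beta> * mfact \<delta>) * mpow \<xi> \<delta> * mpow \<eta> \<beta>) =
      (\<Prod>i\<in>UNIV. of_nat (\<gamma> $ i choose g i) * \<eta> $ i ^ g i * \<xi> $ i ^ (\<gamma> $ i - g i))"
      using g by (simp add: mfact_def mpow_def binomial_fact prod.distrib prod_dividef)
  next
    fix z :: "(nat ^ 'a) \<times> (nat ^ 'a)"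
    assume "z \<in> {(\<beta>, \<delta>). \<beta> + \<delta> = \<gamma>}"
    then obtain \<beta> \<delta> where z: "z = (\<beta>, \<delta>)" "\<gamma> = \<beta> + \<delta>"
      by auto
    show "(vec_lambda (case z of (\<beta>, \<delta>) \<Rightarrow> vec_nth \<beta>), \<gamma> - vec_lambda (case z of (\<beta>, \<delta>) \<Rightarrow> vec_nth \<beta>)) = z"
      by (simp add: z vec_eq_iff)
    show "(case z of (\<beta>, \<delta>) \<Rightarrow> vec_nth \<beta>) \<in> PiE UNIV (\<lambda>i. {..\<gamma> $ i})"
      by (auto simp: z)
  qed auto
  finally show ?thesis .
qed

text \<open>Expand every monomial and collect the terms with the same \<beta>. The coefficient of
  index \<beta> + \<delta> then carries the factor (\<beta> + \<delta>)!/\<delta>!, which makes it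
  the coefficient of index \<delta> in \<open>mderiv \<beta> p\<close>; what remains is
  1/\<beta>!.\<close>

lemma meval_taylor:
  assumes "degree_le p m"
  shows "meval p (\<xi> + \<eta>) =
    (\<Sum>\<beta> | mlength \<beta> \<le> m. meval (mderiv \<beta> p) \<xi> * of_real (mpow \<eta> \<beta> / mfact \<beta>))"
proof -
  define S :: "(nat ^ 'a) set" where "S = {\<alpha>. mlength \<alpha> \<le> m}"
  define h where "h \<beta> \<delta> = Poly_Mapping.lookup p (\<beta> + \<delta>) *
    of_real (mfact (\<beta> + \<delta>) / (mfact \<beta> * mfact \<delta>) * mpow \<xi> \<delta> * mpow \<eta> \<beta>)" for \<beta> \<delta>
  have fS: "finite S"
    unfolding S_def by (rule finite_mlength_le)
  have sub: "{(\<beta>, \<delta>). \<beta> + \<delta> = \<gamma>} \<subseteq> S \<times> S" if "\<gamma> \<in> S" for \<gamma>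
    using that by (auto simp: S_def mlength_add)
  have "meval p (\<xi> + \<eta>) = (\<Sum>\<gamma>\<in>S. \<Sum>(\<beta>, \<delta>) | \<beta> + \<delta> = \<gamma>. h \<beta> \<delta>)"
    unfolding meval_eq_sum[OF assms] S_def[symmetric] mpow_add_eq_sum of_real_sum sum_distrib_left
    by (intro sum.cong refl) (auto simp: h_def)
  also have "\<dots> = (\<Sum>z\<in>(\<Union>\<gamma>\<in>S. {(\<beta>, \<delta>). \<beta> + \<delta> = \<gamma>}). case z of (\<beta>, \<delta>) \<Rightarrow> h \<beta> \<delta>)"
    by (rule sum.UNION_disjoint[symmetric])
       (use sub fS in \<open>auto intro: finite_subset[OF sub] finite_cartesian_product\<close>)
  \<comment> \<open>The added pairs have \<beta> + \<delta> of length above \<open>m\<close>, where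
    the coefficient of \<open>p\<close> is 0.\<close>
  also have "\<dots> = (\<Sum>z\<in>S \<times> S. case z of (\<beta>, \<delta>) \<Rightarrow> h \<beta> \<delta>)"
  proof (rule sum.mono_neutral_left)
    show "\<forall>z\<in>S \<times> S - (\<Union>\<gamma>\<in>S. {(\<beta>, \<delta>). \<beta> + \<delta> = \<gamma>}). (case z of (\<beta>, \<delta>) \<Rightarrow> h \<beta> \<delta>) = 0"
      using assms by (auto simp: h_def S_def degree_le_def)
  qed (use sub fS in auto)
  also have "\<dots> = (\<Sum>\<beta>\<in>S. \<Sum>\<delta>\<in>S. h \<beta> \<delta>)"
    by (rule sum.cartesian_product[symmetric])
  also have "\<dots> = (\<Sum>\<beta>\<in>S. meval (mderiv \<beta> p) \<xi> * of_real (mpow \<eta> \<beta> / mfact \<beta>))"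
  proof (rule sum.cong[OF refl])
    fix \<beta>
    have "h \<beta> \<delta> = Poly_Mapping.lookup (mderiv \<beta> p) \<delta> * of_real (mpow \<xi> \<delta>) * of_real (mpow \<eta> \<beta> / mfact \<beta>)" for \<delta>
      by (simp add: h_def mderiv.rep_eq mfact_def prod_dividef mult_ac)
    then show "(\<Sum>\<delta>\<in>S. h \<beta> \<delta>) = meval (mderiv \<beta> p) \<xi> * of_real (mpow \<eta> \<beta> / mfact \<beta>)"
      by (simp add: meval_eq_sum[OF degree_le_mderiv[OF assms]] S_def sum_distrib_right sum_divide_distrib)
  qed
  finally show ?thesis
    by (simp add: S_def)
qed

section \<open>Estimates for \<open>mtilde\<close> as a Euclidean norm\<close>

lemma mtilde_eq_L2_set:
  assumes "degree_le q m"
  shows "mtilde q \<xi> t = L2_set (\<lambda>\<alpha>. cmod (meval (mderiv \<alpha> q) \<xi>) * t ^ mlength \<alpha>) {\<alpha>. mlength \<alpha> \<le> m}"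
  by (simp add: mtilde_eq_sum[OF assms] L2_set_def power_mult_distrib power_mult[symmetric] mult.commute)

lemma mtilde_nonneg:
  assumes "degree_le q m"
  shows "mtilde q \<xi> t \<ge> 0"
  by (simp add: mtilde_eq_L2_set[OF assms])

lemma mtilde_mono:
  assumes "degree_le q m" "0 \<le> s" "s \<le> t"
  shows "mtilde q \<xi> s \<le> mtilde q \<xi> t"
  unfolding mtilde_eq_L2_set[OF assms(1)]
  by (rule L2_set_mono) (use assms in \<open>auto intro: mult_left_mono power_mono\<close>)

lemma mtilde_le_sum:
  assumes "degree_le q m" "t \<ge> 0"
  shows "mtilde q \<xi> t \<le> (\<Sum>\<alpha> | mlength \<alpha> \<le> m. cmod (meval (mderiv \<alpha> q) \<xi>) * t ^ mlength \<alpha>)"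
  unfolding mtilde_eq_L2_set[OF assms(1)] by (rule L2_set_le_sum) (use assms in auto)

text \<open>A component is at most the Euclidean norm, and derivatives of order above
  \<open>m\<close> vanish. Long \<alpha> are included because Taylor's formula produces indices
  \<alpha> + \<beta> whose length may exceed \<open>m\<close>.\<close>

lemma mderiv_le_mtilde:
  assumes "degree_le q m"
  shows "cmod (meval (mderiv \<alpha> q) \<xi>) * t ^ mlength \<alpha> \<le> mtilde q \<xi> t"
proof (cases "mlength \<alpha> \<le> m")
  case True
  then show ?thesis
    unfolding mtilde_eq_L2_set[OF assms] by (intro member_le_L2_set finite_mlength_le) auto
next
  case False
  then show ?thesis
    using mderiv_eq_0[OF assms, of \<alpha>] mtilde_nonneg[OF assms] by (simp add: meval_def)
qed

text \<open>Taylor's formula is applied to each \<open>mderiv \<alpha> p\<close>. As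
  \<open>mpow \<eta> \<beta>\<close> is at most \<open>t ^ mlength \<beta>\<close> in absolute
  value, the weights combine to that of \<alpha> + \<beta>, and every term is at most
  \<open>mtilde p \<xi> t\<close>. One factor of the cardinality counts the \<beta>, the other comes
  from bounding the Euclidean norm by the sum over \<alpha>.\<close>

lemma mtilde_translate:
  fixes p :: "(complex, 'n::finite) mpoly"
  assumes p: "degree_le p m" and \<eta>: "\<And>i. \<bar>\<eta> $ i\<bar> \<le> t"
  shows "mtilde p (\<xi> + \<eta>) t \<le> (real (card {\<alpha> :: nat ^ 'n. mlength \<alpha> \<le> m}))\<^sup>2 * mtilde p \<xi> t"
proof -
  define S :: "(nat ^ 'n) set" where "S = {\<alpha>. mlength \<alpha> \<le> m}"
  \<comment> \<open>The index type is nonempty, so \<open>t\<close> bounds some absolute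
    value.\<close>
  have t: "t \<ge> 0"
    using \<eta> abs_ge_zero order_trans by blast
  have "cmod (meval (mderiv \<alpha> p) (\<xi> + \<eta>)) * t ^ mlength \<alpha> \<le> (\<Sum>\<beta>\<in>S. mtilde p \<xi> t)" for \<alpha>
  proof -
    have "cmod (meval (mderiv \<alpha> p) (\<xi> + \<eta>)) \<le>
        (\<Sum>\<beta>\<in>S. cmod (meval (mderiv \<beta> (mderiv \<alpha> p)) \<xi> * of_real (mpow \<eta> \<beta> / mfact \<beta>)))"
      unfolding meval_taylor[OF degree_le_mderiv[OF p]] S_def by (rule norm_sum)
    also have "\<dots> \<le> (\<Sum>\<beta>\<in>S. cmod (meval (mderiv (\<alpha> + \<beta>) p) \<xi>) * t ^ mlength \<beta>)"
    proof (rule sum_mono)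
      fix \<beta>
      have "\<bar>mpow \<eta> \<beta> / mfact \<beta>\<bar> \<le> \<bar>mpow \<eta> \<beta>\<bar> / 1"
        unfolding abs_divide using mfact_ge_1[of \<beta>] by (intro divide_left_mono) auto
      also have "\<dots> \<le> t ^ mlength \<beta>"
        using abs_mpow_le[OF \<eta>] by simp
      finally show "cmod (meval (mderiv \<beta> (mderiv \<alpha> p)) \<xi> * of_real (mpow \<eta> \<beta> / mfact \<beta>)) \<le>
          cmod (meval (mderiv (\<alpha> + \<beta>) p) \<xi>) * t ^ mlength \<beta>"
        unfolding norm_mult norm_of_real mderiv_add[symmetric] add.commute[of \<beta> \<alpha>]
        by (rule mult_left_mono) simp
    qed
    finally have "cmod (meval (mderiv \<alpha> p) (\<xi> + \<eta>)) * t ^ mlength \<alpha> \<le>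
        (\<Sum>\<beta>\<in>S. cmod (meval (mderiv (\<alpha> + \<beta>) p) \<xi>) * t ^ mlength \<beta>) * t ^ mlength \<alpha>"
      using t by (intro mult_right_mono) auto
    also have "\<dots> = (\<Sum>\<beta>\<in>S. cmod (meval (mderiv (\<alpha> + \<beta>) p) \<xi>) * t ^ mlength (\<alpha> + \<beta>))"
      unfolding sum_distrib_right by (simp add: mlength_add power_add mult_ac)
    also have "\<dots> \<le> (\<Sum>\<beta>\<in>S. mtilde p \<xi> t)"
      by (rule sum_mono) (rule mderiv_le_mtilde[OF p])
    finally show ?thesis .
  qed
  then have "(\<Sum>\<alpha>\<in>S. cmod (meval (mderiv \<alpha> p) (\<xi> + \<eta>)) * t ^ mlength \<alpha>) \<le> (\<Sum>\<alpha>\<in>S. \<Sum>\<beta>\<in>S. mtilde p \<xi> t)"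
    by (rule sum_mono)
  then show ?thesis
    using mtilde_le_sum[OF p t, of "\<xi> + \<eta>"] by (simp add: S_def power2_eq_square mult.assoc)
qed

section \<open>Recovering coefficients from values on a grid\<close>

text \<open>The weight \<open>w a j\<close> is the coefficient of X^a in the Lagrange basis
  polynomial of the node \<open>x j\<close>. The identity compares coefficients of X^a in the
  interpolation formula for X^b.\<close>

lemma interpolation_weights:
  fixes x :: "nat \<Rightarrow> 'a::field"
  assumes "inj_on x {..k}"
  obtains w where "\<And>a b. b \<le> k \<Longrightarrow> (\<Sum>j\<le>k. w a j * x j ^ b) = (if a = b then 1 else 0)"
proof
  define L where "L j = (\<Prod>i\<in>{..k} - {j}. smult (inverse (x j - x i)) [:- x i, 1:])" for j
  have L: "poly (L j) (x i) = (if i = j then 1 else 0)" if "i \<le> k" "j \<le> k" for i j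
  proof (cases "i = j")
    case True
    have "poly (smult (inverse (x j - x l)) [:- x l, 1:]) (x j) = 1" if "l \<in> {..k} - {j}" for l
    proof -
      have "x j - x l \<noteq> 0"
        using assms that \<open>j \<le> k\<close> by (auto dest: inj_onD)
      from left_inverse[OF this] show ?thesis
        by (simp add: algebra_simps)
    qed
    with True show ?thesis
      by (simp add: L_def poly_prod)
  next
    case False
    then show ?thesis
      using that by (auto simp: L_def poly_prod intro!: prod_zero bexI[of _ i])
  qed
  have deg: "degree (L j) \<le> k" if "j \<le> k" for j
  proof -
    have "degree (L j) \<le> (\<Sum>i\<in>{..k} - {j}. degree (smult (inverse (x j - x i)) [:- x i, 1:]))"
      unfolding L_def by (rule order_trans[OF degree_prod_sum_le]) (simp_all only: o_def finite_Diff finite_atMost order_refl)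
    also have "\<dots> \<le> (\<Sum>i\<in>{..k} - {j}. 1)"
      by (intro sum_mono order_trans[OF degree_smult_le]) simp
    also have "\<dots> = k"
      using that by simp
    finally show ?thesis .
  qed
  fix a b assume b: "b \<le> k"
  \<comment> \<open>X^b is its own interpolant: both sides have degree at most \<open>k\<close> and
    agree at \<open>k + 1\<close> distinct nodes.\<close>
  have eq: "(\<Sum>j\<le>k. smult (x j ^ b) (L j)) = monom 1 b"
  proof (rule poly_eqI_degree[of "x ` {..k}"])
    fix y assume "y \<in> x ` {..k}"
    then obtain i where i: "i \<le> k" "y = x i" by auto
    have "poly (\<Sum>j\<le>k. smult (x j ^ b) (L j)) y = (\<Sum>j\<le>k. if i = j then x j ^ b else 0)"
      unfolding poly_sum poly_smult i(2) by (intro sum.cong refl) (use L i in auto)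
    then show "poly (\<Sum>j\<le>k. smult (x j ^ b) (L j)) y = poly (monom 1 b) y"
      using i by (simp add: poly_monom)
  next
    have "degree (\<Sum>j\<le>k. smult (x j ^ b) (L j)) \<le> k"
      by (rule degree_sum_le) (auto intro: deg)
    then show "card (x ` {..k}) > degree (\<Sum>j\<le>k. smult (x j ^ b) (L j))"
      using assms by (simp add: card_image)
    show "card (x ` {..k}) > degree (monom (1::'a) b)"
      using assms b by (simp add: card_image degree_monom_eq)
  qed
  show "(\<Sum>j\<le>k. coeff (L j) a * x j ^ b) = (if a = b then 1 else 0)"
    using arg_cong[OF eq, of "\<lambda>p. coeff p a"] by (simp add: coeff_sum mult.commute eq_commute)
qed

text \<open>Tensor product of one-dimensional interpolation. \<open>G\<close> and \<open>W\<close>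
  are fixed before \<open>c\<close>, so constants built from them are uniform in the
  polynomial.\<close>

lemma coeff_from_grid:
  fixes k :: nat
  obtains G :: "(real ^ 'n::finite) set" and W where
    "finite G" "\<And>x i. x \<in> G \<Longrightarrow> \<bar>x $ i\<bar> \<le> 1"
    "\<And>(c :: nat ^ 'n \<Rightarrow> complex) \<alpha>. mlength \<alpha> \<le> k \<Longrightarrow>
       c \<alpha> = (\<Sum>x\<in>G. of_real (W \<alpha> x) * (\<Sum>\<beta> | mlength \<beta> \<le> k. c \<beta> * of_real (mpow x \<beta>)))"
proof -
  \<comment> \<open>The nodes 1, 1/2, ..., 1/(k + 1) are distinct and at most 1, which keeps the
    grid in the unit cube.\<close>
  define x where "x j = inverse (real (Suc j))" for j
  have "inj_on x {..k}"
    by (auto simp: x_def inj_on_def)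
  then obtain w where w: "\<And>a b. b \<le> k \<Longrightarrow> (\<Sum>j\<le>k. w a j * x j ^ b) = (if a = b then 1 else 0)"
    by (rule interpolation_weights) blast
  \<comment> \<open>A multi-index of length at most \<open>k\<close> has all exponents at most
    \<open>k\<close>, so \<open>k + 1\<close> nodes per coordinate suffice.\<close>
  define J :: "('n \<Rightarrow> nat) set" where "J = PiE UNIV (\<lambda>_. {..k})"
  define pt :: "('n \<Rightarrow> nat) \<Rightarrow> real ^ 'n" where "pt g = (\<chi> i. x (g i))" for g
  define V where "V \<alpha> g = (\<Prod>i\<in>UNIV. w (\<alpha> $ i) (g i))" for \<alpha> :: "nat ^ 'n" and g
  have inj: "inj_on pt J"
    by (auto simp: inj_on_def pt_def x_def vec_eq_iff)
  have orth: "(\<Sum>g\<in>J. V \<alpha> g * mpow (pt g) \<beta>) = (if \<alpha> = \<beta> then 1 else 0)" if "mlength \<beta> \<le> k" for \<alpha> \<beta>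
  proof -
    have \<beta>: "\<beta> $ i \<le> k" for i
      using that nth_le_mlength order_trans by blast
    have "(\<Sum>g\<in>J. V \<alpha> g * mpow (pt g) \<beta>) = (\<Sum>g\<in>J. \<Prod>i\<in>UNIV. w (\<alpha> $ i) (g i) * x (g i) ^ (\<beta> $ i))"
      by (simp add: V_def mpow_def pt_def prod.distrib)
    \<comment> \<open>The sum over the grid factors over the coordinates, and each factor is a
      Kronecker delta by the choice of \<open>w\<close>.\<close>
    also have "\<dots> = (\<Prod>i\<in>UNIV. \<Sum>j\<le>k. w (\<alpha> $ i) j * x j ^ (\<beta> $ i))"
      unfolding J_def by (rule prod_sum_PiE[symmetric]) auto
    also have "\<dots> = (\<Prod>i\<in>UNIV. if \<alpha> $ i = \<beta> $ i then 1 else 0)"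
      by (simp add: w \<beta>)
    also have "\<dots> = (if \<alpha> = \<beta> then 1 else 0)"
      by (auto simp: vec_eq_iff)
    finally show ?thesis .
  qed
  show ?thesis
  \<comment> \<open>\<open>V\<close> is indexed by choices of nodes; the inverse of
    \<open>pt\<close> turns it into a weight on grid points.\<close>
  proof (rule that[of "pt ` J" "\<lambda>\<alpha> y. V \<alpha> (the_inv_into J pt y)"])
    show "finite (pt ` J)"
      unfolding J_def by (intro finite_imageI finite_PiE) auto
    show "\<bar>y $ i\<bar> \<le> 1" if "y \<in> pt ` J" for y i
      using that by (auto simp: pt_def x_def inverse_le_1_iff)
    fix c :: "nat ^ 'n \<Rightarrow> complex" and \<alpha> :: "nat ^ 'n"
    assume \<alpha>: "mlength \<alpha> \<le> k"
    have "(\<Sum>y\<in>pt ` J. of_real (V \<alpha> (the_inv_into J pt y)) * (\<Sum>\<beta> | mlength \<beta> \<le> k. c \<beta> * of_real (mpow y \<beta>)))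
        = (\<Sum>g\<in>J. of_real (V \<alpha> g) * (\<Sum>\<beta> | mlength \<beta> \<le> k. c \<beta> * of_real (mpow (pt g) \<beta>)))"
      by (simp add: sum.reindex[OF inj] the_inv_into_f_f[OF inj])
    also have "\<dots> = (\<Sum>\<beta> | mlength \<beta> \<le> k. c \<beta> * of_real (\<Sum>g\<in>J. V \<alpha> g * mpow (pt g) \<beta>))"
      by (simp add: sum_distrib_left mult_ac sum.swap[of _ J])
    also have "\<dots> = (\<Sum>\<beta> | mlength \<beta> \<le> k. if \<alpha> = \<beta> then c \<beta> else 0)"
      by (rule sum.cong) (auto simp: orth)
    also have "\<dots> = c \<alpha>"
      using \<alpha> by (simp add: finite_mlength_le)
    finally show "c \<alpha> = (\<Sum>y\<in>pt ` J. of_real (V \<alpha> (the_inv_into J pt y)) *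
        (\<Sum>\<beta> | mlength \<beta> \<le> k. c \<beta> * of_real (mpow y \<beta>)))" ..
  qed
qed

section \<open>From pointwise bounds on \<open>q\<close> to bounds on \<open>mtilde\<close>\<close>

text \<open>The coefficients of the polynomial x \<mapsto> q(\<xi> + t x) are combinations of its
  values on the grid, where \<open>q\<close> is bounded by \<open>B\<close>. Rescaling by
  \<open>t\<close> moves the powers of \<open>t\<close> into these coefficients, so \<open>K\<close>
  depends only on the dimension and on \<open>k\<close>.\<close>

lemma mtilde_le_of_meval_bound:
  obtains K :: real where
    "\<And>(q :: (complex, 'n::finite) mpoly) \<xi> t B. \<lbrakk>degree_le q k; t \<ge> 0;
       \<And>\<eta>. (\<And>i. \<bar>\<eta> $ i\<bar> \<le> t) \<Longrightarrow> cmod (meval q (\<xi> + \<eta>)) \<le> B\<rbrakk> \<Longrightarrow> mtilde q \<xi> t \<le> K * B"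
proof -
  obtain G :: "(real ^ 'n) set" and W where G: "finite G" "\<And>x i. x \<in> G \<Longrightarrow> \<bar>x $ i\<bar> \<le> 1"
    and W: "\<And>(c :: nat ^ 'n \<Rightarrow> complex) \<alpha>. mlength \<alpha> \<le> k \<Longrightarrow>
       c \<alpha> = (\<Sum>x\<in>G. of_real (W \<alpha> x) * (\<Sum>\<beta> | mlength \<beta> \<le> k. c \<beta> * of_real (mpow x \<beta>)))"
    by (rule coeff_from_grid) blast
  show ?thesis
  \<comment> \<open>The sum of the absolute weights bounds one coefficient,
    \<open>mfact \<alpha>\<close> undoes the division in Taylor's formula, and the outer sum bounds
    the Euclidean norm.\<close>
  proof (rule that[of "\<Sum>\<alpha> | mlength \<alpha> \<le> k. mfact \<alpha> * (\<Sum>x\<in>G. \<bar>W \<alpha> x\<bar>)"])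
    fix q :: "(complex, 'n) mpoly" and \<xi> t B
    assume q: "degree_le q k" and t: "t \<ge> 0"
      and B: "\<And>\<eta>. (\<And>i. \<bar>\<eta> $ i\<bar> \<le> t) \<Longrightarrow> cmod (meval q (\<xi> + \<eta>)) \<le> B"
    define c where "c \<beta> = meval (mderiv \<beta> q) \<xi> * of_real (t ^ mlength \<beta> / mfact \<beta>)" for \<beta>
    have val: "(\<Sum>\<beta> | mlength \<beta> \<le> k. c \<beta> * of_real (mpow x \<beta>)) = meval q (\<xi> + t *\<^sub>R x)" for x
      by (simp add: meval_taylor[OF q] mpow_scaleR c_def mult_ac)
    have "cmod (meval (mderiv \<alpha> q) \<xi>) * t ^ mlength \<alpha> \<le> mfact \<alpha> * (\<Sum>x\<in>G. \<bar>W \<alpha> x\<bar>) * B"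
      if \<alpha>: "mlength \<alpha> \<le> k" for \<alpha>
    proof -
      have "cmod (c \<alpha>) \<le> (\<Sum>x\<in>G. cmod (of_real (W \<alpha> x) * meval q (\<xi> + t *\<^sub>R x)))"
        unfolding W[OF \<alpha>, of c] val by (rule norm_sum)
      also have "\<dots> \<le> (\<Sum>x\<in>G. \<bar>W \<alpha> x\<bar> * B)"
      proof (rule sum_mono)
        fix x assume "x \<in> G"
        then have "\<bar>(t *\<^sub>R x) $ i\<bar> \<le> t" for i
          using mult_left_mono[OF G(2) t] t by (simp add: abs_mult)
        then show "cmod (of_real (W \<alpha> x) * meval q (\<xi> + t *\<^sub>R x)) \<le> \<bar>W \<alpha> x\<bar> * B"
          unfolding norm_mult norm_of_real by (intro mult_left_mono B) auto
      qed
      also have "\<dots> = (\<Sum>x\<in>G. \<bar>W \<alpha> x\<bar>) * B"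
        by (simp add: sum_distrib_right)
      finally show ?thesis
        using mfact_pos[of \<alpha>] t by (simp add: c_def norm_mult norm_divide norm_power field_simps)
    qed
    then have "(\<Sum>\<alpha> | mlength \<alpha> \<le> k. cmod (meval (mderiv \<alpha> q) \<xi>) * t ^ mlength \<alpha>) \<le>
        (\<Sum>\<alpha> | mlength \<alpha> \<le> k. mfact \<alpha> * (\<Sum>x\<in>G. \<bar>W \<alpha> x\<bar>) * B)"
      by (intro sum_mono) auto
    then show "mtilde q \<xi> t \<le> (\<Sum>\<alpha> | mlength \<alpha> \<le> k. mfact \<alpha> * (\<Sum>x\<in>G. \<bar>W \<alpha> x\<bar>)) * B"
      using mtilde_le_sum[OF q t, of \<xi>] by (simp add: sum_distrib_right)
  qed
qed

text \<open>On the cube of radius \<open>t\<close> around \<xi>, translation bounds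
  \<open>mtilde p\<close> by a multiple of \<open>mtilde p \<xi> t\<close>, so \<open>q\<close>
  obeys the bound required by the previous lemma. \<open>K\<close> is fixed before the polynomials
  and can therefore serve all \<epsilon> at once.\<close>

lemma mtilde_comparison:
  obtains K :: real where
    "\<And>(q :: (complex, 'n::finite) mpoly) p C \<xi> t. \<lbrakk>degree_le q k; degree_le p m; C \<ge> 0; t \<ge> 1;
       \<And>\<zeta>. cmod (meval q \<zeta>) \<le> C * mtilde p \<zeta> 1\<rbrakk> \<Longrightarrow> mtilde q \<xi> t \<le> K * C * mtilde p \<xi> t"
proof -
  obtain K where K: "\<And>(q :: (complex, 'n) mpoly) \<xi> t B. \<lbrakk>degree_le q k; t \<ge> 0;
       \<And>\<eta>. (\<And>i. \<bar>\<eta> $ i\<bar> \<le> t) \<Longrightarrow> cmod (meval q (\<xi> + \<eta>)) \<le> B\<rbrakk> \<Longrightarrow> mtilde q \<xi> t \<le> K * B"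
    by (rule mtilde_le_of_meval_bound) blast
  define M where "M = (real (card {\<alpha> :: nat ^ 'n. mlength \<alpha> \<le> m}))\<^sup>2"
  show ?thesis
  proof (rule that[of "K * M"])
    fix q p :: "(complex, 'n) mpoly" and C t :: real and \<xi>
    assume q: "degree_le q k" and p: "degree_le p m" and C: "C \<ge> 0" and t: "t \<ge> 1"
      and bound: "\<And>\<zeta>. cmod (meval q \<zeta>) \<le> C * mtilde p \<zeta> 1"
    have "cmod (meval q (\<xi> + \<eta>)) \<le> C * (M * mtilde p \<xi> t)" if "\<And>i. \<bar>\<eta> $ i\<bar> \<le> t" for \<eta>
    proof -
      \<comment> \<open>Here \<open>t \<ge> 1\<close> enters: the hypothesis bounds \<open>q\<close>
        by \<open>mtilde p\<close> with weight 1.\<close>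
      have "mtilde p (\<xi> + \<eta>) 1 \<le> mtilde p (\<xi> + \<eta>) t"
        by (rule mtilde_mono[OF p]) (use t in auto)
      also have "\<dots> \<le> M * mtilde p \<xi> t"
        unfolding M_def by (rule mtilde_translate[OF p that])
      finally show ?thesis
        using bound[of "\<xi> + \<eta>"] mult_left_mono[OF _ C] order_trans by blast
    qed
    from K[OF q _ this] show "mtilde q \<xi> t \<le> K * M * C * mtilde p \<xi> t"
      using t by (simp add: mult_ac)
  qed
qed

section \<open>Equivalence of the three conditions\<close>

theorem proposition1p8:
  fixes Q P :: "(gcomplex, 'n::finite) mpoly" and k m :: nat
  assumes "degree_le Q k" and "degree_le P m"
  shows "(weaker k Q m P \<longleftrightarrow>
            (\<exists>q p (l :: real \<Rightarrow> real).
               representative k Q q \<and> representative m P p \<and> moderate l \<and>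
               (\<forall>\<xi>. \<forall>\<epsilon>\<in>{0<..1}. cmod (meval (q \<epsilon>) \<xi>) \<le> l \<epsilon> * mtilde (p \<epsilon>) \<xi> 1)))
       \<and> (weaker k Q m P \<longleftrightarrow>
            (\<exists>q p (l' :: real \<Rightarrow> real).
               representative k Q q \<and> representative m P p \<and> moderate l' \<and>
               (\<forall>\<xi>. \<forall>\<epsilon>\<in>{0<..1}. \<forall>t\<ge>1. mtilde (q \<epsilon>) \<xi> t \<le> l' \<epsilon> * mtilde (p \<epsilon>) \<xi> t)))"
    (is "(_ \<longleftrightarrow> ?ii) \<and> (_ \<longleftrightarrow> ?iii)")
proof -
  \<comment> \<open>The implications form a cycle. The representatives are kept throughout; only the
    step to \<open>?iii\<close> changes the net.\<close>
  have i_ii: ?ii if "weaker k Q m P"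
  proof -
    from that obtain p q and l :: "real \<Rightarrow> real" where *: "representative m P p" "representative k Q q" "moderate l"
      "\<forall>\<xi>. \<forall>\<epsilon>\<in>{0<..1}. mtilde (q \<epsilon>) \<xi> 1 \<le> l \<epsilon> * mtilde (p \<epsilon>) \<xi> 1"
      unfolding weaker_def by blast
    have "cmod (meval (q \<epsilon>) \<xi>) \<le> l \<epsilon> * mtilde (p \<epsilon>) \<xi> 1" if "\<epsilon> \<in> {0<..1}" for \<epsilon> \<xi>
    proof -
      have "degree_le (q \<epsilon>) k"
        using *(2) that by (simp add: representative_def)
      \<comment> \<open>The term of \<open>mtilde\<close> with \<alpha> = 0 is the modulus of
        \<open>q\<close> itself.\<close>
      from mderiv_le_mtilde[OF this, of 0 \<xi> 1] have "cmod (meval (q \<epsilon>) \<xi>) \<le> mtilde (q \<epsilon>) \<xi> 1"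
        by (simp add: mderiv_0)
      with *(4) that show ?thesis
        by (meson order_trans)
    qed
    with * show ?thesis
      by blast
  qed
  have ii_iii: ?iii if ?ii
  proof -
    from that obtain q p and l :: "real \<Rightarrow> real" where *: "representative k Q q" "representative m P p" "moderate l"
      and bound: "\<forall>\<xi>. \<forall>\<epsilon>\<in>{0<..1}. cmod (meval (q \<epsilon>) \<xi>) \<le> l \<epsilon> * mtilde (p \<epsilon>) \<xi> 1"
      by blast
    obtain K where K: "\<And>(q :: (complex, 'n) mpoly) p C \<xi> t. \<lbrakk>degree_le q k; degree_le p m; C \<ge> 0; t \<ge> 1;
       \<And>\<zeta>. cmod (meval q \<zeta>) \<le> C * mtilde p \<zeta> 1\<rbrakk> \<Longrightarrow> mtilde q \<xi> t \<le> K * C * mtilde p \<xi> t"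
      by (rule mtilde_comparison[of k m]) blast
    \<comment> \<open>\<open>l\<close> is not assumed nonnegative; the absolute value only enlarges
      the right-hand side because \<open>mtilde\<close> is nonnegative.\<close>
    have "mtilde (q \<epsilon>) \<xi> t \<le> K * \<bar>l \<epsilon>\<bar> * mtilde (p \<epsilon>) \<xi> t" if \<epsilon>: "\<epsilon> \<in> {0<..1}" and t: "t \<ge> 1" for \<epsilon> \<xi> t
    proof (rule K)
      show "degree_le (q \<epsilon>) k" and p: "degree_le (p \<epsilon>) m"
        using * \<epsilon> by (auto simp: representative_def)
      show "cmod (meval (q \<epsilon>) \<zeta>) \<le> \<bar>l \<epsilon>\<bar> * mtilde (p \<epsilon>) \<zeta> 1" for \<zeta>
        using bound \<epsilon> mult_right_mono[OF abs_ge_self mtilde_nonneg[OF p]] by (meson order_trans)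
    qed (use t in auto)
    \<comment> \<open>Moderateness survives because \<open>K\<close> does not depend on
      \<epsilon>.\<close>
    moreover have "moderate (\<lambda>\<epsilon>. K * \<bar>l \<epsilon>\<bar>)"
      using *(3) by (intro moderate_mult moderate_const) (simp add: moderate_def)
    ultimately show ?thesis
      using * by (intro exI[of _ q] exI[of _ p] exI[of _ "\<lambda>\<epsilon>. K * \<bar>l \<epsilon>\<bar>"]) blast
  qed
  \<comment> \<open>This is the case \<open>t = 1\<close>.\<close>
  have iii_i: "weaker k Q m P" if ?iii
    using that unfolding weaker_def by (meson order_refl)
  show ?thesis
    using i_ii ii_iii iii_i by blast
qed

end
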